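(* Let $k\ge 1$ and $s\ge 1$ be integers. Every $k$-uniform $[1,s]$-almost intersecting multihypergraph has at most $s\binom{2k}{k}$ edges (counted with multiplicity). Moreover, up to isomorphism the unique such multihypergraph with exactly $s\binom{2k}{k}$ edges is the multihypergraph consisting of all $k$-element subsets of $[2k]$, each taken with multiplicity $s$; this multihypergraph is $s$-almost intersecting.
   Context: A $k$-uniform multihypergraph is a finite collection of $k$-element sets (edges) in which repeated edges are allowed; distinct copies of the same set count as distinct edges. For integers $0\le a\le b$, a (multi)hypergraph $\mathcal{F}$ is $[a,b]$-almost intersecting if for every edge $A\in\mathcal{F}$ the number of edges $B\in\mathcal{F}$ with $A\cap B=\emptyset$ (copies counted separately) lies between $a$ and $b$ inclusive. It is $s$-almost intersecting if it is $[s,s]$-almost intersecting. $[n]=\{1,\dots,n\}$. *)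

theory Defs
  imports "HOL-Library.Multiset"
begin

text \<open>
  A multihypergraph is given by its finite multiset of edges; the multiplicity of a set is the
  number of its copies. There is no separate vertex set: the vertices are those lying in an edge.
\<close>

type_synonym 'a multihypergraph = "'a set multiset"

definition vertices :: "'a multihypergraph \<Rightarrow> 'a set" where
  "vertices F = \<Union> (set_mset F)"

definition uniform :: "nat \<Rightarrow> 'a multihypergraph \<Rightarrow> bool" where
  "uniform k F \<longleftrightarrow> (\<forall>A \<in># F. finite A \<and> card A = k)"

definition interval_almost_intersecting :: "nat \<Rightarrow> nat \<Rightarrow> 'a multihypergraph \<Rightarrow> bool" where
  "interval_almost_intersecting a b F \<longleftrightarrow>
     (\<forall>A \<in># F. size {#B \<in># F. A \<inter> B = {}#} \<in> {a..b})"

definition almost_intersecting :: "nat \<Rightarrow> 'a multihypergraph \<Rightarrow> bool" where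
  "almost_intersecting s F \<longleftrightarrow> interval_almost_intersecting s s F"

definition isomorphic :: "'a multihypergraph \<Rightarrow> 'b multihypergraph \<Rightarrow> bool" where
  "isomorphic F G \<longleftrightarrow>
     (\<exists>f. bij_betw f (vertices F) (vertices G) \<and> image_mset (\<lambda>A. f ` A) F = G)"

definition complete_multihypergraph :: "nat \<Rightarrow> nat \<Rightarrow> nat \<Rightarrow> nat multihypergraph" where
  "complete_multihypergraph n k s = repeat_mset s (mset_set {A. A \<subseteq> {1..n} \<and> card A = k})"

end

theory Submission
  imports Defs "HOL-Combinatorics.Multiset_Permutations"
begin

text \<open>
  Order the vertices uniformly at random and give an ordered pair of disjoint edges \<open>A\<close>, \<open>B\<close> with
  \<open>A\<close> entirely before \<open>B\<close> the weight \<open>1 / deg A\<close>, where \<open>deg A\<close> counts the edges disjoint from \<open>A\<close>.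
  The pair occurs with probability \<open>1 / (2k choose k)\<close>, so the expected total weight is the number
  of edges divided by \<open>2k choose k\<close>. On the other hand, for a fixed ordering all edges that precede
  some edge precede a common edge \<open>B\<close>; hence there are at most \<open>deg B \<le> s\<close> of them, each
  contributing at most \<open>1\<close>.

  In the case of equality every ordering has total weight \<open>s\<close>. Suitable orderings then show that
  the edges disjoint from a given edge are copies of one set, that every multiplicity is \<open>s\<close>, and
  that exchanging one element between two disjoint edges yields edges again. So all \<open>k\<close>-subsets of
  the union of two disjoint edges are edges, and counting shows that there are no others.
\<close>

section \<open>Precedence of sets in a linear order, and how many orders realise it\<close>

definition precedes :: "'a list \<Rightarrow> 'a set \<Rightarrow> 'a set \<Rightarrow> bool" where
  "precedes xs A B \<longleftrightarrow> (\<exists>ys zs. xs = ys @ zs \<and> A \<subseteq> set ys \<and> B \<subseteq> set zs)"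

lemma precedes_appendI: "A \<subseteq> set ys \<Longrightarrow> B \<subseteq> set zs \<Longrightarrow> precedes (ys @ zs) A B"
  unfolding precedes_def by blast

lemma precedes_disjoint: "distinct xs \<Longrightarrow> precedes xs A B \<Longrightarrow> A \<inter> B = {}"
  unfolding precedes_def by fastforce

text \<open>Of two cuts of one list, one lies at or before the other. The first set of the earlier
  cut then also lies before the later cut, and so precedes the second set there.\<close>

lemma precedes_cross:
  assumes "precedes xs A B" "precedes xs A' B'"
  shows "precedes xs A B' \<or> precedes xs A' B"
proof -
  obtain ys zs where 1: "xs = ys @ zs" "A \<subseteq> set ys" "B \<subseteq> set zs"
    using assms(1) unfolding precedes_def by blast
  obtain ys' zs' where 2: "xs = ys' @ zs'" "A' \<subseteq> set ys'" "B' \<subseteq> set zs'"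
    using assms(2) unfolding precedes_def by blast
  from 1(1) 2(1) obtain us where "ys = ys' @ us \<and> us @ zs = zs' \<or> ys @ us = ys' \<and> zs = us @ zs'"
    using append_eq_append_conv2 by metis
  then show ?thesis
  proof
    assume "ys = ys' @ us \<and> us @ zs = zs'"
    then have "A' \<subseteq> set ys" using 2 by auto
    then show ?thesis using 1 by (auto intro: precedes_appendI)
  next
    assume "ys @ us = ys' \<and> zs = us @ zs'"
    then have "A \<subseteq> set ys'" using 1 by auto
    then show ?thesis using 2 by (auto intro: precedes_appendI)
  qed
qed

lemma precedes_map_iff:
  assumes "inj f"
  shows "precedes (map f xs) (f ` A) (f ` B) \<longleftrightarrow> precedes xs A B"
proof
  assume "precedes (map f xs) (f ` A) (f ` B)"
  then obtain ys zs where *: "map f xs = ys @ zs" "f ` A \<subseteq> set ys" "f ` B \<subseteq> set zs"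
    unfolding precedes_def by blast
  then obtain us vs where "xs = us @ vs" "ys = map f us" "zs = map f vs"
    by (auto simp: map_eq_append_conv)
  then show "precedes xs A B"
    using * assms by (auto intro!: precedes_appendI simp: inj_image_subset_iff)
next
  assume "precedes xs A B"
  then obtain ys zs where "xs = ys @ zs" "A \<subseteq> set ys" "B \<subseteq> set zs"
    unfolding precedes_def by blast
  then show "precedes (map f xs) (f ` A) (f ` B)"
    by (auto intro!: precedes_appendI)
qed

text \<open>\<open>C\<close> consists of the first \<open>k\<close> elements of \<open>Y\<close> in
  the order of \<open>xs\<close>; the induction collects them greedily.\<close>

lemma ex1_precedes_complement:
  assumes "distinct xs" "Y \<subseteq> set xs" "k \<le> card Y"
  shows "\<exists>!C. C \<subseteq> Y \<and> card C = k \<and> precedes xs C (Y - C)"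
proof (rule ex_ex1I)
  show "\<exists>C. C \<subseteq> Y \<and> card C = k \<and> precedes xs C (Y - C)"
    using assms
  proof (induction xs arbitrary: Y k)
    case Nil
    then show ?case by (auto simp: precedes_def)
  next
    case (Cons x xs)
    show ?case
    proof (cases "x \<in> Y \<and> k > 0")
      case False
      show ?thesis
      proof (cases "k = 0")
        case True
        then show ?thesis
          using Cons.prems precedes_appendI[of "{}" "[]" Y "x # xs"] by auto
      next
        case k: False
        then have "Y \<subseteq> set xs" using False Cons.prems by auto
        then obtain C where C: "C \<subseteq> Y" "card C = k" "precedes xs C (Y - C)"
          using Cons.IH[of Y k] Cons.prems by auto
        then have "precedes (x # xs) C (Y - C)"
          unfolding precedes_def by (metis append_Cons set_subset_Cons subset_trans)
        then show ?thesis using C by blast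
      qed
    next
      case True
      have fin: "finite Y" using Cons.prems finite_subset by blast
      have "Y - {x} \<subseteq> set xs" "k - 1 \<le> card (Y - {x})"
        using Cons.prems True fin by auto
      then obtain C where C: "C \<subseteq> Y - {x}" "card C = k - 1" "precedes xs C (Y - {x} - C)"
        using Cons.IH[of "Y - {x}" "k - 1"] Cons.prems by auto
      then obtain ys zs where "xs = ys @ zs" "C \<subseteq> set ys" "Y - {x} - C \<subseteq> set zs"
        unfolding precedes_def by blast
      then have "precedes ((x # ys) @ zs) (insert x C) (Y - insert x C)"
        by (intro precedes_appendI) auto
      moreover have "card (insert x C) = k"
        using C True fin by (subst card_insert_disjoint) (auto intro: finite_subset)
      ultimately show ?thesis
        using C True \<open>xs = ys @ zs\<close> by (intro exI[of _ "insert x C"]) auto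
    qed
  qed
next
  fix C D
  assume C: "C \<subseteq> Y \<and> card C = k \<and> precedes xs C (Y - C)"
    and D: "D \<subseteq> Y \<and> card D = k \<and> precedes xs D (Y - D)"
  have fin: "finite C" "finite D"
    using C D assms(2) by (meson List.finite_set finite_subset)+
  \<comment> \<open>Crossing lets \<open>C\<close> precede \<open>Y - D\<close> or \<open>D\<close>
    precede \<open>Y - C\<close>, so one of \<open>C\<close>, \<open>D\<close> contains the other;
    equal size does the rest.\<close>
  have "C \<inter> (Y - D) = {} \<or> D \<inter> (Y - C) = {}"
    using precedes_cross precedes_disjoint assms(1) C D by metis
  then have "C \<subseteq> D \<or> D \<subseteq> C" using C D by blast
  then show "C = D" using C D fin by (metis card_subset_eq)
qed

text \<open>Symmetry: a permutation of \<open>X\<close> that carries \<open>A\<close> to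
  \<open>C\<close> and \<open>B\<close> to the rest of \<open>A \<union> B\<close> acts bijectively
  on the orderings of \<open>X\<close>.\<close>

lemma card_permutations_precedes_eq:
  assumes "finite X" "A \<union> B \<subseteq> X" "A \<inter> B = {}" "C \<subseteq> A \<union> B" "card C = card A"
  shows "card {xs \<in> permutations_of_set X. precedes xs C (A \<union> B - C)} =
         card {xs \<in> permutations_of_set X. precedes xs A B}"
proof -
  have fin: "finite A" "finite B" "finite C"
    using assms by (meson Un_subset_iff finite_Un finite_subset)+
  have "card (A \<union> B - C) = card B"
    using assms fin by (simp add: card_Diff_subset card_Un_disjoint)
  then obtain g h where g: "bij_betw g A C" and h: "bij_betw h B (A \<union> B - C)"
    using assms(5) fin by (metis finite_same_card_bij finite_Diff finite_Un)
  \<comment> \<open>Extended by the identity, \<open>f\<close> is a bijection of the whole type, so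
    \<open>precedes_map_iff\<close> applies and \<open>map f\<close> can be inverted.\<close>
  define f where "f x = (if x \<in> A then g x else if x \<in> B then h x else x)" for x
  have fA: "bij_betw f A C"
    using g by (rule bij_betw_cong[THEN iffD1, rotated]) (simp add: f_def)
  have fB: "bij_betw f B (A \<union> B - C)"
    using h assms(3) by (subst bij_betw_cong[where g = h]) (auto simp: f_def)
  have AB: "bij_betw f (A \<union> B) (A \<union> B)"
    using bij_betw_combine[OF fA fB] assms(4) by (simp add: Un_absorb1)
  have id: "bij_betw f (-(A \<union> B)) (-(A \<union> B))"
    by (subst bij_betw_cong[where g = id]) (auto simp: f_def)
  have "bij f"
    using bij_betw_combine[OF AB id] by (simp only: Compl_partition Compl_disjoint simp_thms)
  then have inj: "inj f" and surj: "surj f" by (auto simp: bij_def)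
  have im: "f ` A = C" "f ` B = A \<union> B - C"
    using fA fB by (auto simp: bij_betw_def)
  have "f ` X = f ` (A \<union> B) \<union> f ` (X - (A \<union> B))"
    using assms(2) by blast
  also have "\<dots> = (A \<union> B) \<union> (X - (A \<union> B))"
    using AB by (simp add: bij_betw_def f_def)
  finally have X: "f ` X = X" using assms(2) by blast
  have "{xs \<in> permutations_of_set X. precedes xs (f ` A) (f ` B)} =
        map f ` {xs \<in> permutations_of_set X. precedes xs A B}" (is "?L = ?R")
  proof
    show "?R \<subseteq> ?L"
      using inj X inj_on_subset[OF inj subset_UNIV]
      by (auto simp: permutations_of_set_def distinct_map precedes_map_iff)
    show "?L \<subseteq> ?R"
    proof
      fix ys assume ys: "ys \<in> ?L"
      define xs where "xs = map (inv f) ys"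
      have "ys = map f xs"
        using surj by (simp add: xs_def surj_iff)
      moreover have "xs \<in> permutations_of_set X"
        using ys X inj_image_eq_iff[OF inj, of "set xs" X] \<open>ys = map f xs\<close>
        by (simp add: permutations_of_set_def distinct_map)
      ultimately show "ys \<in> ?R"
        using ys inj by (auto simp: precedes_map_iff)
    qed
  qed
  moreover have "inj_on (map f) Z" for Z
    using inj by (meson inj_mapI inj_on_subset subset_UNIV)
  ultimately show ?thesis by (simp add: card_image im)
qed

text \<open>Classify the orderings by the set \<open>C\<close> of the first \<open>card A\<close>
  elements of \<open>A \<union> B\<close>. There is one class for each such subset, and by symmetry
  all classes have equal size.\<close>

lemma card_permutations_precedes:
  assumes "finite X" "A \<union> B \<subseteq> X" "A \<inter> B = {}"
  shows "((card A + card B) choose card A) * card {xs \<in> permutations_of_set X. precedes xs A B} =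
         fact (card X)"
proof -
  have fin: "finite A" "finite B"
    using assms by (meson Un_subset_iff finite_subset)+
  define P where "P = {C. C \<subseteq> A \<union> B \<and> card C = card A}"
  define R where "R C = {xs \<in> permutations_of_set X. precedes xs C (A \<union> B - C)}" for C
  have ex1: "\<exists>!C. C \<in> P \<and> xs \<in> R C" if "xs \<in> permutations_of_set X" for xs
    using ex1_precedes_complement[of xs "A \<union> B" "card A"] that assms fin
    by (auto simp: P_def R_def permutations_of_set_def card_mono)
  have "permutations_of_set X = (\<Union>C\<in>P. R C)"
    using ex1 by (fastforce simp: R_def)
  moreover have "card (\<Union>C\<in>P. R C) = (\<Sum>C\<in>P. card (R C))"
  proof (rule card_UN_disjoint)
    show "finite P" using fin by (simp add: P_def)
    show "\<forall>C\<in>P. finite (R C)" by (simp add: R_def)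
    show "\<forall>C\<in>P. \<forall>D\<in>P. C \<noteq> D \<longrightarrow> R C \<inter> R D = {}"
      using ex1 unfolding R_def by blast
  qed
  moreover have "(\<Sum>C\<in>P. card (R C)) =
      (\<Sum>C\<in>P. card {xs \<in> permutations_of_set X. precedes xs A B})"
    using card_permutations_precedes_eq[OF assms] by (intro sum.cong) (auto simp: P_def R_def)
  moreover have "card P = (card A + card B) choose card A"
    using n_subsets[of "A \<union> B" "card A"] fin assms(3) by (simp add: P_def card_Un_disjoint)
  ultimately have "card (permutations_of_set X) =
      ((card A + card B) choose card A) * card {xs \<in> permutations_of_set X. precedes xs A B}"
    by (simp only: sum_constant of_nat_id)
  then show ?thesis
    using assms(1) by simp
qed

section \<open>Sizes of filtered multisets, and repeated multisets\<close>

lemma size_filter_mset_eq_sum: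
  "size {#x \<in># M. P x#} = (\<Sum>x\<in>{x \<in> set_mset M. P x}. count M x)"
  by (simp add: size_multiset_overloaded_eq)

lemma set_mset_repeat_mset: "set_mset (repeat_mset n M) = (if n = 0 then {} else set_mset M)"
  by (induction n) auto

lemma image_mset_repeat_mset: "image_mset f (repeat_mset n M) = repeat_mset n (image_mset f M)"
  by (induction n) auto

lemma filter_mset_repeat_mset: "filter_mset P (repeat_mset n M) = repeat_mset n (filter_mset P M)"
  by (induction n) auto

section \<open>Weighted double counting and the upper bound\<close>

locale almost_intersecting_multihypergraph =
  fixes k s :: nat and F :: "'a multihypergraph"
  assumes k_pos: "k \<ge> 1" and s_pos: "s \<ge> 1"
    and unif: "uniform k F"
    and almost: "interval_almost_intersecting 1 s F"
begin

text \<open>A sum over distinct edges with multiplicities, so that it can be compared directly with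
  partial sums such as those over \<open>later xs A\<close>.\<close>

definition deg :: "'a set \<Rightarrow> nat" where
  "deg A = (\<Sum>B\<in>{B \<in> set_mset F. A \<inter> B = {}}. count F B)"

definition orderings :: "'a list set" where
  "orderings = permutations_of_set (vertices F)"

definition later :: "'a list \<Rightarrow> 'a set \<Rightarrow> 'a set set" where
  "later xs A = {B \<in> set_mset F. precedes xs A B}"

definition initial :: "'a list \<Rightarrow> 'a set set" where
  "initial xs = {A \<in> set_mset F. later xs A \<noteq> {}}"

definition weight :: "'a list \<Rightarrow> real" where
  "weight xs = (\<Sum>A\<in>set_mset F. real (count F A) * (\<Sum>B\<in>later xs A. real (count F B)) / real (deg A))"

lemma edge: "A \<in># F \<Longrightarrow> finite A" "A \<in># F \<Longrightarrow> card A = k"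
  using unif by (auto simp: uniform_def)

lemma edge_nonempty: "A \<in># F \<Longrightarrow> A \<noteq> {}"
  using edge k_pos by force

lemma edge_subset: "A \<in># F \<Longrightarrow> A \<subseteq> vertices F"
  by (auto simp: vertices_def)

lemma finite_vertices: "finite (vertices F)"
  using edge by (auto simp: vertices_def)

lemma deg_bounds: "A \<in># F \<Longrightarrow> 1 \<le> deg A" "A \<in># F \<Longrightarrow> deg A \<le> s"
  using almost
  by (auto simp: interval_almost_intersecting_def deg_def simp flip: size_filter_mset_eq_sum)

lemma ex_disjoint_edge:
  assumes "A \<in># F"
  obtains B where "B \<in># F" "A \<inter> B = {}"
proof -
  have "{B \<in> set_mset F. A \<inter> B = {}} \<noteq> {}"
    using deg_bounds(1)[OF assms] unfolding deg_def by (metis sum.empty not_one_le_zero)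
  then show ?thesis using that by blast
qed

lemma ordering_distinct: "xs \<in> orderings \<Longrightarrow> distinct xs"
  by (simp add: orderings_def permutations_of_set_def)

lemma ex_ordering_prefix:
  assumes "distinct ys" "set ys \<subseteq> vertices F"
  obtains zs where "ys @ zs \<in> orderings" "set zs = vertices F - set ys"
proof -
  obtain zs where "distinct zs" "set zs = vertices F - set ys"
    using finite_distinct_list[of "vertices F - set ys"] finite_vertices by blast
  then show ?thesis
    using assms that[of zs] by (auto simp: orderings_def permutations_of_set_def)
qed

lemma later_subset:
  "xs \<in> orderings \<Longrightarrow> later xs A \<subseteq> {B \<in> set_mset F. A \<inter> B = {}}"
  using ordering_distinct precedes_disjoint by (fastforce simp: later_def)

lemma sum_later_le:
  assumes "xs \<in> orderings"
  shows "(\<Sum>B\<in>later xs A. real (count F B)) \<le> real (deg A)"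
  unfolding deg_def of_nat_sum
  using later_subset[OF assms] by (intro sum_mono2) auto

text \<open>If the new edge \<open>A\<close> does not precede the common \<open>B\<close>, then by
  crossing all edges of \<open>L\<close> precede the edge \<open>B'\<close> that follows
  \<open>A\<close>.\<close>

lemma common_later:
  assumes "finite L" "L \<noteq> {}" "L \<subseteq> initial xs"
  shows "\<exists>B\<in>set_mset F. \<forall>A\<in>L. precedes xs A B"
  using assms
proof (induction rule: finite_ne_induct)
  case (singleton A)
  then show ?case by (auto simp: initial_def later_def)
next
  case (insert A L)
  then obtain B where B: "B \<in># F" "\<forall>A\<in>L. precedes xs A B" by auto
  obtain B' where B': "B' \<in># F" "precedes xs A B'"
    using insert.prems by (auto simp: initial_def later_def)
  show ?case
  proof (cases "precedes xs A B")
    case True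
    then show ?thesis using B by auto
  next
    case False
    then have "\<forall>A\<in>L. precedes xs A B'" using B B' precedes_cross by metis
    then show ?thesis using B' by auto
  qed
qed

text \<open>All initial edges precede a common edge \<open>B\<close>, hence are disjoint from it and
  are counted by \<open>deg B\<close>.\<close>

lemma sum_initial_le:
  assumes "xs \<in> orderings"
  shows "(\<Sum>A\<in>initial xs. count F A) \<le> s"
proof (cases "initial xs = {}")
  case False
  have "finite (initial xs)" by (simp add: initial_def)
  then obtain B where B: "B \<in># F" "\<forall>A\<in>initial xs. precedes xs A B"
    using common_later[of "initial xs"] False by blast
  have "initial xs \<subseteq> {A \<in> set_mset F. B \<inter> A = {}}"
    using B(2) precedes_disjoint[OF ordering_distinct[OF assms]] by (fastforce simp: initial_def)
  then have "(\<Sum>A\<in>initial xs. count F A) \<le> deg B"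
    unfolding deg_def by (intro sum_mono2) auto
  also have "\<dots> \<le> s" using B deg_bounds by simp
  finally show ?thesis .
qed simp

lemma weight_eq:
  "weight xs = (\<Sum>A\<in>initial xs. real (count F A) * (\<Sum>B\<in>later xs A. real (count F B)) / real (deg A))"
  unfolding weight_def by (intro sum.mono_neutral_right) (auto simp: initial_def)

lemma weight_term_le:
  assumes "xs \<in> orderings" "A \<in># F"
  shows "real (count F A) * (\<Sum>B\<in>later xs A. real (count F B)) / real (deg A) \<le> real (count F A)"
proof -
  have "real (count F A) * (\<Sum>B\<in>later xs A. real (count F B)) \<le> real (count F A) * real (deg A)"
    using sum_later_le[OF assms(1)] by (intro mult_left_mono) auto
  then show ?thesis
    using deg_bounds(1)[OF assms(2)] by (simp add: divide_le_eq)
qed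

lemma weight_le_sum_initial:
  assumes "xs \<in> orderings"
  shows "weight xs \<le> real (\<Sum>A\<in>initial xs. count F A)"
  unfolding weight_eq of_nat_sum
  using weight_term_le[OF assms] by (intro sum_mono) (auto simp: initial_def)

lemma weight_le:
  assumes "xs \<in> orderings"
  shows "weight xs \<le> real s"
  using weight_le_sum_initial[OF assms] sum_initial_le[OF assms] by linarith

text \<open>Double counting: each edge disjoint from \<open>A\<close> follows it in the same number
  \<open>q\<close> of orderings, so the factor \<open>deg A\<close> cancels the denominator and
  every copy of \<open>A\<close> contributes \<open>q\<close>.\<close>

lemma sum_weight:
  "real (2 * k choose k) * (\<Sum>xs\<in>orderings. weight xs) = real (size F) * real (card orderings)"
proof -
  define q where "q = real (card orderings) / real (2 * k choose k)"
  have card_ord: "card orderings = fact (card (vertices F))"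
    using finite_vertices by (simp add: orderings_def)
  have fin: "finite orderings" by (simp add: orderings_def)
  have cpos: "(2 * k choose k) > 0" by simp
  have prob: "real (card {xs \<in> orderings. precedes xs A B}) = q"
    if "A \<in># F" "B \<in># F" "A \<inter> B = {}" for A B
  proof -
    have "(2 * k choose k) * card {xs \<in> orderings. precedes xs A B} = card orderings"
      using card_permutations_precedes[of "vertices F" A B] that edge edge_subset finite_vertices
      by (simp add: card_ord orderings_def mult_2)
    then show ?thesis
      using cpos by (simp add: q_def field_simps flip: of_nat_mult)
  qed
  have never: "{xs \<in> orderings. precedes xs A B} = {}" if "A \<inter> B \<noteq> {}" for A B
    using that ordering_distinct precedes_disjoint by blast
  have count: "(\<Sum>xs\<in>orderings. \<Sum>B\<in>later xs A. real (count F B)) = real (deg A) * q"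
    if "A \<in># F" for A
  proof -
    have "(\<Sum>xs\<in>orderings. \<Sum>B\<in>later xs A. real (count F B)) =
        (\<Sum>B\<in>set_mset F. \<Sum>xs\<in>{xs \<in> orderings. precedes xs A B}. real (count F B))"
      unfolding later_def using fin by (intro sum.swap_restrict) auto
    also have "\<dots> = (\<Sum>B\<in>set_mset F. if A \<inter> B = {} then real (count F B) * q else 0)"
    proof (rule sum.cong)
      fix B assume "B \<in> set_mset F"
      then show "(\<Sum>xs\<in>{xs \<in> orderings. precedes xs A B}. real (count F B)) =
          (if A \<inter> B = {} then real (count F B) * q else 0)"
        using prob[OF that, of B] by (cases "A \<inter> B = {}") (simp_all add: never)
    qed simp
    also have "\<dots> = real (deg A) * q"
      by (simp add: deg_def sum.inter_filter sum_distrib_right if_distrib if_distribR cong: if_cong)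
    finally show ?thesis .
  qed
  have "(\<Sum>xs\<in>orderings. weight xs) =
      (\<Sum>A\<in>set_mset F. real (count F A) / real (deg A) *
        (\<Sum>xs\<in>orderings. \<Sum>B\<in>later xs A. real (count F B)))"
    unfolding weight_def
    by (subst sum.swap) (simp only: sum_distrib_left sum_divide_distrib times_divide_eq_left)
  also have "\<dots> = (\<Sum>A\<in>set_mset F. real (count F A) * q)"
  proof (rule sum.cong)
    fix A assume "A \<in> set_mset F"
    then show "real (count F A) / real (deg A) *
        (\<Sum>xs\<in>orderings. \<Sum>B\<in>later xs A. real (count F B)) = real (count F A) * q"
      using deg_bounds(1)[of A] by (simp only: count) simp
  qed simp
  also have "\<dots> = real (size F) * q"
    by (simp add: size_multiset_overloaded_eq sum_distrib_right)
  finally show ?thesis using cpos by (simp add: q_def)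
qed

lemma card_orderings_pos: "card orderings > 0"
  using finite_vertices by (simp add: orderings_def)

text \<open>The average of \<open>weight\<close> over all orderings is at most its pointwise bound
  \<open>s\<close>.\<close>

lemma size_le: "size F \<le> s * (2 * k choose k)"
proof -
  have "(\<Sum>xs\<in>orderings. weight xs) \<le> real (card orderings) * real s"
    using sum_bounded_above[of orderings weight "real s"] weight_le by simp
  then have "real (2 * k choose k) * (\<Sum>xs\<in>orderings. weight xs) \<le>
      real (2 * k choose k) * (real (card orderings) * real s)"
    by (intro mult_left_mono) auto
  then have "real (size F) * real (card orderings) \<le>
      real (s * (2 * k choose k)) * real (card orderings)"
    unfolding sum_weight by (simp add: mult_ac)
  then show ?thesis
    using card_orderings_pos by (simp only: mult_le_cancel_right of_nat_le_iff)
qed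

end

section \<open>Structure in the case of equality\<close>

locale extremal_multihypergraph = almost_intersecting_multihypergraph +
  assumes size_eq: "size F = s * (2 * k choose k)"
begin

text \<open>The average weight is now \<open>s\<close>, which is also an upper bound for every
  single weight.\<close>

lemma weight_eq_s:
  assumes "xs \<in> orderings"
  shows "weight xs = real s"
proof (rule ccontr)
  assume "weight xs \<noteq> real s"
  then have "weight xs < real s" using weight_le[OF assms] by simp
  then have "(\<Sum>xs\<in>orderings. weight xs) < (\<Sum>xs\<in>orderings. real s)"
    using assms weight_le by (intro sum_strict_mono_ex1) (auto simp: orderings_def)
  moreover have "(\<Sum>xs\<in>orderings. weight xs) = (\<Sum>xs\<in>orderings. real s)"
    using sum_weight by (simp add: size_eq)
  ultimately show False by simp
qed

lemma sum_initial:
  assumes "xs \<in> orderings"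
  shows "(\<Sum>A\<in>initial xs. count F A) = s"
  using weight_le_sum_initial[OF assms] sum_initial_le[OF assms] weight_eq_s[OF assms] by linarith

text \<open>An edge disjoint from \<open>A\<close> but missing from \<open>later xs A\<close> would
  make the term of \<open>A\<close> strictly smaller than \<open>count F A\<close>, and so the total
  smaller than \<open>s\<close>.\<close>

lemma precedes_all_disjoint:
  assumes xs: "xs \<in> orderings" and "A \<in># F" "B \<in># F" "precedes xs A B" "B' \<in># F" "A \<inter> B' = {}"
  shows "precedes xs A B'"
proof (rule ccontr)
  assume "\<not> precedes xs A B'"
  then have "B' \<in> {B \<in> set_mset F. A \<inter> B = {}} - later xs A"
    using assms by (simp add: later_def)
  then have "(\<Sum>B\<in>later xs A. real (count F B)) < real (deg A)"
    unfolding deg_def of_nat_sum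
    using later_subset[OF xs] assms by (intro sum_strict_mono2[of _ _ B']) auto
  then have "real (count F A) * (\<Sum>B\<in>later xs A. real (count F B)) / real (deg A) < real (count F A)"
    using \<open>A \<in># F\<close> deg_bounds(1)[of A] by (simp add: divide_less_eq)
  moreover have "A \<in> initial xs" using assms by (auto simp: initial_def later_def)
  ultimately have "weight xs < (\<Sum>A\<in>initial xs. real (count F A))"
    unfolding weight_eq using weight_term_le[OF xs]
    by (intro sum_strict_mono_ex1) (auto simp: initial_def)
  also have "\<dots> = real s" using sum_initial[OF xs] by (simp flip: of_nat_sum)
  finally show False using weight_eq_s[OF xs] by simp
qed

text \<open>Take an ordering that starts with some \<open>b\<close> in \<open>B' - B\<close>,
  followed by \<open>A\<close>. There \<open>A\<close> precedes \<open>B\<close> but not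
  \<open>B'\<close>, against \<open>precedes_all_disjoint\<close>.\<close>

lemma disjoint_edge_unique:
  assumes "A \<in># F" "B \<in># F" "B' \<in># F" "A \<inter> B = {}" "A \<inter> B' = {}"
  shows "B = B'"
proof (rule ccontr)
  assume "B \<noteq> B'"
  then obtain b where b: "b \<in> B'" "b \<notin> B"
    using edge assms by (metis card_subset_eq subsetI)
  obtain as where as: "distinct as" "set as = A"
    using finite_distinct_list edge assms by metis
  have "distinct (b # as)" "set (b # as) \<subseteq> vertices F"
    using as b assms edge_subset by auto
  then obtain zs where zs: "(b # as) @ zs \<in> orderings" "set zs = vertices F - set (b # as)"
    using ex_ordering_prefix by metis
  have "B \<subseteq> set zs" using zs(2) as b assms edge_subset[of B] by auto
  then have "precedes ((b # as) @ zs) A B"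
    using as by (intro precedes_appendI) auto
  then have "precedes ((b # as) @ zs) A B'"
    using precedes_all_disjoint zs(1) assms by blast
  then obtain us vs where uv: "(b # as) @ zs = us @ vs" "A \<subseteq> set us" "B' \<subseteq> set vs"
    unfolding precedes_def by blast
  \<comment> \<open>Since \<open>A\<close> is nonempty, the cut lies after the head
    \<open>b\<close>.\<close>
  have "us \<noteq> []" using uv(2) edge_nonempty assms by auto
  then have "b \<in> set us" using uv(1) by (cases us) auto
  moreover have "distinct (us @ vs)" using ordering_distinct zs(1) uv(1) by metis
  ultimately show False using b uv(3) by auto
qed

text \<open>Both edges are disjoint from a common later edge, which has only one disjoint
  partner.\<close>

lemma initial_unique:
  assumes "xs \<in> orderings" "A \<in> initial xs" "A' \<in> initial xs"
  shows "A = A'"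
proof -
  obtain B where "B \<in># F" "precedes xs A B" "precedes xs A' B"
    using common_later[of "{A, A'}" xs] assms by auto
  then show ?thesis
    using assms precedes_disjoint[OF ordering_distinct[OF assms(1)]] disjoint_edge_unique[of B A A']
    by (auto simp: initial_def Int_commute)
qed

text \<open>In an ordering that starts with \<open>A\<close>, the edge \<open>A\<close> is the only
  initial one, so its multiplicity alone makes up the sum \<open>s\<close>.\<close>

lemma count_edge:
  assumes "A \<in># F"
  shows "count F A = s"
proof -
  obtain B where B: "B \<in># F" "A \<inter> B = {}" using ex_disjoint_edge assms by blast
  obtain as where as: "distinct as" "set as = A"
    using finite_distinct_list edge assms by metis
  then obtain zs where zs: "as @ zs \<in> orderings" "set zs = vertices F - set as"
    using ex_ordering_prefix assms edge_subset by metis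
  have "precedes (as @ zs) A B"
    using as zs B edge_subset[of B] by (intro precedes_appendI) auto
  then have "A \<in> initial (as @ zs)"
    using assms B by (auto simp: initial_def later_def)
  then have "initial (as @ zs) = {A}"
    using initial_unique[OF zs(1)] by blast
  then show ?thesis using sum_initial[OF zs(1)] by simp
qed

text \<open>Order the vertices as \<open>A - {a}\<close>, then \<open>b\<close>, then
  \<open>a\<close>, then the rest. Some edge \<open>C\<close> precedes an edge \<open>D\<close>
  here. A cut after \<open>a\<close> would make \<open>D\<close> disjoint from \<open>A\<close>, so
  \<open>D = B\<close>, although \<open>b\<close> lies before the cut. Hence \<open>C\<close> lies
  among the first \<open>k\<close> vertices and equals their set.\<close>

lemma exchange:
  assumes "A \<in># F" "B \<in># F" "A \<inter> B = {}" "a \<in> A" "b \<in> B"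
  shows "insert b (A - {a}) \<in># F"
proof -
  obtain as where as: "distinct as" "set as = A - {a}"
    using finite_distinct_list edge assms by (metis finite_Diff)
  have ab: "b \<notin> A" "a \<notin> B" "a \<noteq> b" using assms by auto
  have "distinct ((as @ [b]) @ [a])" "set ((as @ [b]) @ [a]) \<subseteq> vertices F"
    using as ab assms edge_subset by auto
  then obtain zs where zs: "((as @ [b]) @ [a]) @ zs \<in> orderings"
    using ex_ordering_prefix by metis
  define xs where "xs = ((as @ [b]) @ [a]) @ zs"
  have xs: "xs \<in> orderings" using zs by (simp add: xs_def)
  have "initial xs \<noteq> {}" using sum_initial[OF xs] s_pos by auto
  then obtain C D where CD: "C \<in># F" "D \<in># F" "precedes xs C D"
    by (auto simp: initial_def later_def)
  then obtain us vs where uv: "xs = us @ vs" "C \<subseteq> set us" "D \<subseteq> set vs"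
    unfolding precedes_def by blast
  have dist: "distinct (us @ vs)" using ordering_distinct xs uv(1) by metis
  have eq: "us @ vs = (as @ [b]) @ (a # zs)" using uv(1) by (simp add: xs_def)
  then obtain ws where "us = (as @ [b]) @ ws \<and> ws @ vs = a # zs \<or> us @ ws = as @ [b] \<and> vs = ws @ a # zs"
    using append_eq_append_conv2 by metis
  \<comment> \<open>The cases are a cut after \<open>a\<close>, where \<open>ws\<close> is nonempty
    with head \<open>a\<close>, and a cut before \<open>a\<close>.\<close>
  then consider "us = (as @ [b]) @ ws" "ws @ vs = a # zs" "ws \<noteq> []" | "set us \<subseteq> insert b (A - {a})"
  proof (elim disjE conjE)
    assume "us @ ws = as @ [b]"
    then have "set us \<subseteq> set (as @ [b])" by (metis Un_upper1 set_append)
    then show ?thesis using that as by simp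
  qed (use that as in \<open>cases "ws = []"; auto\<close>)
  then show ?thesis
  proof cases
    case 1
    then have "a \<in> set ws" by (cases ws) auto
    then have sub: "A \<subseteq> set us" "b \<in> set us" using 1 as assms by auto
    then have "A \<inter> D = {}" using uv dist by auto
    then have "B = D" using disjoint_edge_unique assms CD by blast
    then show ?thesis using sub dist uv(3) \<open>b \<in> B\<close> by auto
  next
    case 2
    have "card (insert b (A - {a})) = k"
      using edge(1)[OF assms(1)] edge(2)[OF assms(1)] ab assms k_pos by simp
    then have "C = insert b (A - {a})"
      using 2 uv(2) edge[OF CD(1)] edge(1)[OF assms(1)]
      by (intro card_subset_eq) auto
    then show ?thesis using CD by simp
  qed
qed

text \<open>Exchanging \<open>a\<close> in \<open>A - C\<close> with \<open>b\<close> in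
  \<open>C - A\<close> in both edges at once keeps them disjoint, preserves their union, and brings
  the first one closer to \<open>C\<close>.\<close>

lemma subset_of_disjoint_edges:
  assumes "A \<in># F" "B \<in># F" "A \<inter> B = {}" "C \<subseteq> A \<union> B" "card C = k"
  shows "C \<in># F"
  using assms
proof (induction "card (C - A)" arbitrary: A B rule: less_induct)
  case less
  have fin: "finite A" "finite B" "finite C"
    using less.prems edge by (auto intro: finite_subset)
  show ?case
  proof (cases "C \<subseteq> A")
    case True
    then show ?thesis using less.prems edge fin card_subset_eq by metis
  next
    case False
    then obtain b where b: "b \<in> C" "b \<notin> A" by blast
    \<comment> \<open>\<open>A\<close> and \<open>C\<close> have the same size and differ.\<close>
    have "\<not> A \<subseteq> C"
      using b less.prems edge fin card_subset_eq by metis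
    then obtain a where a: "a \<in> A" "a \<notin> C" by blast
    have bB: "b \<in> B" using b less.prems by blast
    have "insert b (A - {a}) \<in># F" "insert a (B - {b}) \<in># F"
      using exchange less.prems a bB by (blast, metis Int_commute)
    moreover have "card (C - insert b (A - {a})) < card (C - A)"
      using a b fin by (intro psubset_card_mono) auto
    moreover have "insert b (A - {a}) \<inter> insert a (B - {b}) = {}"
      "C \<subseteq> insert b (A - {a}) \<union> insert a (B - {b})"
      using less.prems a b bB by auto
    ultimately show ?thesis using less.hyps less.prems by blast
  qed
qed

text \<open>\<open>Y\<close> is the union of two disjoint edges. All its \<open>k\<close>-subsets
  are edges, and since every multiplicity is \<open>s\<close>, the size of \<open>F\<close> leaves
  room for no others.\<close>

lemma edges_eq_subsets:
  obtains Y where "finite Y" "card Y = 2 * k" "set_mset F = {C. C \<subseteq> Y \<and> card C = k}"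
proof -
  have "size F > 0" using size_eq s_pos by simp
  then obtain A where A: "A \<in># F" by (metis multiset_nonemptyE nonempty_has_size)
  obtain B where B: "B \<in># F" "A \<inter> B = {}" using ex_disjoint_edge A by blast
  define P where "P = {C. C \<subseteq> A \<union> B \<and> card C = k}"
  have fin: "finite (A \<union> B)" using A B edge by auto
  have card: "card (A \<union> B) = 2 * k" using A B edge by (simp add: card_Un_disjoint)
  have "s * card (set_mset F) = size F"
    using count_edge by (simp add: size_multiset_overloaded_eq)
  then have "card (set_mset F) = card P"
    using size_eq s_pos fin card by (simp add: P_def n_subsets)
  moreover have "P \<subseteq> set_mset F"
    using subset_of_disjoint_edges[OF A B] unfolding P_def by blast
  ultimately have "set_mset F = P"
    by (metis card_subset_eq finite_set_mset)
  then show ?thesis using that[OF fin card] by (simp add: P_def)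
qed

text \<open>Any bijection from \<open>Y\<close> to \<open>{1..2 * k}\<close> serves as the
  isomorphism.\<close>

lemma isomorphic_complete: "isomorphic F (complete_multihypergraph (2 * k) k s)"
proof -
  obtain Y where Y: "finite Y" "card Y = 2 * k" "set_mset F = {C. C \<subseteq> Y \<and> card C = k}"
    using edges_eq_subsets .
  have F: "F = repeat_mset s (mset_set (set_mset F))"
    using count_edge by (intro multiset_eqI) (auto simp: count_mset_set' not_in_iff)
  \<comment> \<open>As \<open>1 \<le> k \<le> 2 * k\<close>, each point lies in some
    \<open>k\<close>-subset; this identifies the vertex sets on both sides.\<close>
  have union: "\<Union> {C. C \<subseteq> Z \<and> card C = k} = Z" if Z: "finite Z" "card Z = 2 * k" for Z :: "'c set"
  proof
    show "Z \<subseteq> \<Union> {C. C \<subseteq> Z \<and> card C = k}"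
    proof
      fix z assume "z \<in> Z"
      then obtain C where "{z} \<subseteq> C" "C \<subseteq> Z" "card C = k"
        using exists_subset_between[of "{z}" k Z] Z k_pos by auto
      then show "z \<in> \<Union> {C. C \<subseteq> Z \<and> card C = k}" by auto
    qed
  qed auto
  have "vertices F = Y" using union Y by (simp add: vertices_def)
  moreover have "vertices (complete_multihypergraph (2 * k) k s) = {1..2 * k}"
    using union[of "{1..2 * k}"] s_pos
    by (simp add: vertices_def complete_multihypergraph_def set_mset_repeat_mset)
  moreover obtain f where f: "bij_betw f Y {1..2 * k}"
    using Y finite_same_card_bij[of Y "{1..2 * k}"] by auto
  moreover have "image_mset (\<lambda>A. f ` A) F = complete_multihypergraph (2 * k) k s"
  proof -
    have inj: "inj_on ((`) f) (set_mset F)"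
      using f Y(3) by (auto simp: bij_betw_def intro: inj_on_subset[OF inj_on_image_Pow])
    have "(`) f ` set_mset F = {C. C \<subseteq> {1..2 * k} \<and> card C = k}" (is "?L = ?R")
    proof
      show "?L \<subseteq> ?R"
        using f Y(3) by (auto simp: bij_betw_def card_image inj_on_subset)
      show "?R \<subseteq> ?L"
      proof
        fix C assume C: "C \<in> ?R"
        then have "C \<subseteq> f ` Y" using f by (simp add: bij_betw_def)
        then obtain D where D: "D \<subseteq> Y" "C = f ` D" by (auto simp: subset_image_iff)
        then have "card D = k"
          using C f by (auto simp: bij_betw_def card_image inj_on_subset)
        then show "C \<in> ?L" using D Y(3) by auto
      qed
    qed
    then show ?thesis
      by (subst F) (simp add: complete_multihypergraph_def image_mset_mset_set inj
          image_mset_repeat_mset)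
  qed
  ultimately show ?thesis unfolding isomorphic_def by metis
qed

end

section \<open>The complete multihypergraph attains the bound\<close>

lemma uniform_complete: "uniform k (complete_multihypergraph n k s)"
  by (auto simp: uniform_def complete_multihypergraph_def set_mset_repeat_mset intro: finite_subset)

lemma size_complete: "size (complete_multihypergraph n k s) = s * (n choose k)"
  by (simp add: complete_multihypergraph_def n_subsets)

text \<open>The only \<open>k\<close>-subset of \<open>{1..2 * k}\<close> disjoint from
  \<open>A\<close> is its complement, which occurs \<open>s\<close> times.\<close>

lemma almost_intersecting_complete: "almost_intersecting s (complete_multihypergraph (2 * k) k s)"
  unfolding almost_intersecting_def interval_almost_intersecting_def
proof
  fix A assume "A \<in># complete_multihypergraph (2 * k) k s"
  then have A: "A \<subseteq> {1..2 * k}" "card A = k" and s: "s > 0"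
    by (auto simp: complete_multihypergraph_def set_mset_repeat_mset split: if_splits)
  have finA: "finite A" using A finite_subset by blast
  have "{B. B \<subseteq> {1..2 * k} \<and> card B = k \<and> A \<inter> B = {}} = {{1..2 * k} - A}"
  proof -
    have "B = {1..2 * k} - A" if "B \<subseteq> {1..2 * k}" "card B = k" "A \<inter> B = {}" for B
      using that A finA by (intro card_subset_eq) (auto simp: card_Diff_subset)
    moreover have "card ({1..2 * k} - A) = k" using A finA by (simp add: card_Diff_subset)
    ultimately show ?thesis by auto
  qed
  then show "size {#B \<in># complete_multihypergraph (2 * k) k s. A \<inter> B = {}#} \<in> {s..s}"
    by (simp add: complete_multihypergraph_def filter_mset_repeat_mset)
qed

theorem theorem2p1:
  fixes k s :: nat
  assumes "k \<ge> 1" and "s \<ge> 1"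
  shows "(\<forall>F :: 'a multihypergraph.
            uniform k F \<and> interval_almost_intersecting 1 s F \<longrightarrow>
              size F \<le> s * ((2 * k) choose k)) \<and>
         (\<forall>F :: 'a multihypergraph.
            uniform k F \<and> interval_almost_intersecting 1 s F \<and>
            size F = s * ((2 * k) choose k) \<longrightarrow>
              isomorphic F (complete_multihypergraph (2 * k) k s)) \<and>
         uniform k (complete_multihypergraph (2 * k) k s) \<and>
         interval_almost_intersecting 1 s (complete_multihypergraph (2 * k) k s) \<and>
         size (complete_multihypergraph (2 * k) k s) = s * ((2 * k) choose k) \<and>
         almost_intersecting s (complete_multihypergraph (2 * k) k s)"
proof (intro conjI allI impI)
  fix F :: "'a multihypergraph"
  assume "uniform k F \<and> interval_almost_intersecting 1 s F"
  then interpret almost_intersecting_multihypergraph k s F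
    using assms by unfold_locales auto
  show "size F \<le> s * ((2 * k) choose k)" by (rule size_le)
next
  fix F :: "'a multihypergraph"
  assume "uniform k F \<and> interval_almost_intersecting 1 s F \<and> size F = s * ((2 * k) choose k)"
  then interpret extremal_multihypergraph k s F
    using assms by unfold_locales auto
  show "isomorphic F (complete_multihypergraph (2 * k) k s)" by (rule isomorphic_complete)
next
  show "interval_almost_intersecting 1 s (complete_multihypergraph (2 * k) k s)"
    using almost_intersecting_complete[of s k] assms(2)
    by (auto simp: almost_intersecting_def interval_almost_intersecting_def)
qed (fact uniform_complete size_complete almost_intersecting_complete)+

end
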